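(* Let $p$ be a prime and let $\nu$ be a positive integer. Let $A$ be a finite abelian group such that $p\nmid |A|$ and let $P$ be a finite abelian $p$-group. Let $C$ be an abelian code in $\mathbb{F}_{p^{2\nu}}[A\times P]$, with components $C_j\subseteq \mathbb{K}_j[P]$ ($1\le j\le r_{I'}$) and $D_l, D_l'\subseteq \mathbb{L}_l[P]$ ($1\le l\le r_{II'}$) under the discrete Fourier transform decomposition described in the context, so that $C\cong \left(\prod_{j=1}^{r_{I'}} C_j\right)\times\left(\prod_{l=1}^{r_{II'}}(D_l\times D_l')\right)$. Then $C$ is Hermitian complementary dual if and only if both of the following hold: 1. $C_j$ is Hermitian complementary dual for all $1\le j\le r_{I'}$; 2. $D_l\cap (D_l')^{\perp_{\rm E}}=\{0\}$ and $D_l'\cap D_l^{\perp_{\rm E}}=\{0\}$ for all $1\le l\le r_{II'}$.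
   Context: For a finite field $F$ and a finite abelian group $G$ (written additively), elements of the group algebra $F[G]$ are written $\sum_{g\in G}u_gY^g$; an abelian code in $F[G]$ is an ideal of $F[G]$. Euclidean inner product: $\langle u,v\rangle_{\rm E}=\sum_g u_gv_g$; $C^{\perp_{\rm E}}=\{v : \langle c,v\rangle_{\rm E}=0\ \forall c\in C\}$. If $|F|=Q^2$ is a square, the Hermitian inner product is $\langle u,v\rangle_{\rm H}=\sum_g u_gv_g^{Q}$, $C^{\perp_{\rm H}}=\{v : \langle c,v\rangle_{\rm H}=0\ \forall c\in C\}$, and $C$ is Hermitian complementary dual if $C\cap C^{\perp_{\rm H}}=\{0\}$. For $a\in A$, the $p^{2\nu}$-cyclotomic class of $a$ is $S_{p^{2\nu}}(a)=\{p^{2\nu i}\cdot a : i\ge 0\}$. It is of type $I'$ if $S_{p^{2\nu}}(a)=S_{p^{2\nu}}(-p^\nu a)$ and of type $II'$ otherwise. Choose representatives $a_1,\dots,a_t$ of the $p^{2\nu}$-cyclotomic classes of $A$ such that $a_1,\dots,a_{r_{I'}}$ represent the classes of type $I'$, and $a_{r_{I'}+l},\ a_{r_{I'}+r_{II'}+l}=-p^\nu a_{r_{I'}+l}$ ($1\le l\le r_{II'}$) represent the classes of type $II'$; $t=r_{I'}+2r_{II'}$. Put $s_i=|S_{p^{2\nu}}(a_i)|$, $\mathbb{K}_j=\mathbb{F}_{p^{2\nu s_j}}$ for $1\le j\le r_{I'}$ and $\mathbb{L}_l=\mathbb{F}_{p^{2\nu s_{r_{I'}+l}}}$ for $1\le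 l\le r_{II'}$. Decomposition: fix an algebraic closure $\overline{\mathbb{F}}$ of $\mathbb{F}_{p^{2\nu}}$ and a group isomorphism $a\mapsto\psi_a$ from $A$ to $\mathrm{Hom}(A,\overline{\mathbb{F}}^{\times})$. For $a\in A$ with $s=|S_{p^{2\nu}}(a)|$ let $\Phi_a,\Phi_a':\mathbb{F}_{p^{2\nu}}[A\times P]\to\mathbb{F}_{p^{2\nu s}}[P]$ be the ring homomorphisms sending $\sum_{(h,b)}\alpha_{(h,b)}Y^{(h,b)}$ to $\sum_{b\in P}\left(\sum_{h\in A}\alpha_{(h,b)}\psi_a(h)\right)Y^b$ and to $\sum_{b\in P}\left(\sum_{h\in A}\alpha_{(h,b)}^{p^\nu}\psi_{-a}(h)\right)Y^b$, respectively ($\Phi_a'$ is the Fourier transform at $-p^\nu a$ followed by the inverse of the Frobenius $x\mapsto x^{p^\nu}$ on coefficients). The map $u\mapsto\left((\Phi_{a_j}(u))_{j\le r_{I'}},(\Phi_{a_{r_{I'}+l}}(u),\Phi'_{a_{r_{I'}+l}}(u))_{l\le r_{II'}}\right)$ is a ring isomorphism $\mathbb{F}_{p^{2\nu}}[A\times P]\cong\left(\prod_{j=1}^{r_{I'}}\mathbb{K}_j[P]\right)\times\left(\prod_{l=1}^{r_{II'}}(\mathbb{L}_l[P]\times\mathbb{L}_l[P])\right)$. The components of an ideal $C$ are $C_j=\Phi_{a_j}(C)$, $D_l=\Phi_{a_{r_{I'}+l}}(C)$, $D_l'=\Phi'_{a_{r_{I'}+l}}(C)$. *)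

theory Defs
  imports
    "HOL-Algebra.Algebraic_Closure_Type"
    "HOL-Library.Cardinality"
    "HOL-Library.Poly_Mapping"
    "HOL-Library.Product_Plus"
begin

section \<open>Finite subfields of an algebraic closure\<close>

text \<open>
  For a power \<open>n > 1\<close> of the characteristic, the field of order \<open>n\<close> inside a fixed algebraic
  closure is the set of roots of \<open>X^n - X\<close>; the lemmas below show that this set is a
  subfield, that it has \<open>n\<close> elements, and that it is the only subfield with \<open>n\<close> elements.
\<close>
definition subfield_of_order :: "nat \<Rightarrow> 'k::field set" where
  "subfield_of_order n = {x. x ^ n = x}"

lemma card_subfield_of_order:
  fixes n m :: nat
  assumes "prime CHAR('k::alg_closed_field)" "n = CHAR('k) ^ m" "m > 0"
  shows "card (subfield_of_order n :: 'k set) = n"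
proof -
  have "CHAR('k) > 1" using assms(1) by (rule prime_gt_1_nat)
  then have n1: "n > 1" using one_less_power[OF _ assms(3)] assms(2) by metis
  define f :: "'k poly" where "f = monom 1 n - monom 1 1"
  have cn: "coeff f n = 1" using n1 by (simp add: f_def)
  then have f0: "f \<noteq> 0" by auto
  have deg: "degree f = n"
  proof (rule antisym)
    show "degree f \<le> n" unfolding f_def
      using n1 by (intro degree_diff_le) (auto intro: order.trans[OF degree_monom_le])
    show "n \<le> degree f" using cn by (intro le_degree) auto
  qed
  have eval: "poly f x = x ^ n - x" for x
    by (simp add: f_def poly_monom)
  have char0: "(of_nat n :: 'k) = 0"
    using assms(2,3) by (simp add: of_nat_eq_0_iff_char_dvd)
  have "pderiv f = [:- 1:]"
    unfolding f_def pderiv_diff pderiv_monom using char0 by (simp add: monom_0)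
  then have pd: "poly (pderiv f) x = - 1" for x by simp
  have ord: "order x f \<le> 1" for x
  proof (rule ccontr)
    assume "\<not> order x f \<le> 1"
    then have "[:-x, 1:] ^ 2 dvd f"
      by (intro order_divides[THEN iffD2] disjI2) simp
    then obtain g where "f = [:-x, 1:] ^ 2 * g" by (elim dvdE)
    then have "f = [:-x, 1:] * ([:-x, 1:] * g)"
      by (simp only: power2_eq_square mult.assoc)
    then have "poly (pderiv f) x = 0"
      by (simp only: pderiv_mult poly_add poly_mult) simp
    with pd show False by simp
  qed
  obtain A where A: "size A = degree f" "f = smult (lead_coeff f) (\<Prod>x\<in>#A. [:-x, 1:])"
    using alg_closed_imp_factorization[OF f0] by blast
  have "proots f = proots (\<Prod>x\<in>#A. [:-x, 1:])"
    using A(2) f0 by (metis leading_coeff_0_iff proots_smult)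
  also have "\<dots> = A"
  proof (induction A)
    case (add y A)
    have "(\<Prod>x\<in>#A. [:-x, 1:]) \<noteq> (0 :: 'k poly)" by (auto simp: prod_mset_zero_iff)
    then show ?case using add by (simp add: proots_mult del: mult_pCons_left)
  qed simp
  finally have pA: "proots f = A" .
  have "count A x = 1" if "x \<in># A" for x
    using ord[of x] that pA f0 by (metis count_eq_zero_iff count_proots le_neq_implies_less less_one)
  then have "card (set_mset A) = size A"
    by (simp add: size_multiset_overloaded_eq)
  moreover have "set_mset A = subfield_of_order n"
    using pA[symmetric] f0 by (simp add: subfield_of_order_def eval)
  ultimately show ?thesis using A(1) deg by simp
qed

lemma subfield_of_order_closed:
  fixes x y :: "'k::field"
  assumes "prime CHAR('k)" "n = CHAR('k) ^ m"
    and "x \<in> subfield_of_order n" "y \<in> subfield_of_order n"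
  shows "0 \<in> (subfield_of_order n :: 'k set)" "1 \<in> (subfield_of_order n :: 'k set)"
    "x + y \<in> subfield_of_order n" "x - y \<in> subfield_of_order n"
    "x * y \<in> subfield_of_order n" "inverse x \<in> subfield_of_order n"
proof -
  have n0: "n > 0" using assms(1,2) by (simp add: prime_gt_0_nat)
  show "0 \<in> (subfield_of_order n :: 'k set)" "1 \<in> (subfield_of_order n :: 'k set)"
    using n0 by (auto simp: subfield_of_order_def)
  show "x + y \<in> subfield_of_order n"
    using assms freshmans_dream'[OF assms(1,2)] by (simp add: subfield_of_order_def)
  show "x * y \<in> subfield_of_order n" "inverse x \<in> subfield_of_order n"
    using assms by (simp_all add: subfield_of_order_def power_mult_distrib power_inverse)
  have "(x - y) ^ n + y ^ n = x ^ n"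
    using freshmans_dream'[OF assms(1,2), of "x - y" y] by simp
  then show "x - y \<in> subfield_of_order n"
    using assms by (simp add: subfield_of_order_def algebra_simps)
qed

lemma subfield_of_order_unique:
  fixes K :: "'k::alg_closed_field set"
  assumes "prime CHAR('k)" "n = CHAR('k) ^ m" "m > 0" "card K = n"
    and "0 \<in> K" "\<And>x y. x \<in> K \<Longrightarrow> y \<in> K \<Longrightarrow> x * y \<in> K" "\<And>x. x \<in> K \<Longrightarrow> inverse x \<in> K"
  shows "K = subfield_of_order n"
proof -
  have n0: "n > 0" using assms(1,2) by (simp add: prime_gt_0_nat)
  have fin: "finite K" using n0 assms(4) card_ge_0_finite by blast
  have "x ^ n = x" if x: "x \<in> K" for x
  proof (cases "x = 0")
    case False
    have "(\<Prod>y\<in>K-{0}. x * y) = (\<Prod>y\<in>K-{0}. y)"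
      using False x assms(6,7)
      by (intro prod.reindex_bij_witness[of _ "\<lambda>y. inverse x * y" "\<lambda>y. x * y"])
         (auto simp: mult.assoc[symmetric])
    then have "x ^ card (K - {0}) * (\<Prod>y\<in>K-{0}. y) = (\<Prod>y\<in>K-{0}. y)"
      by (simp add: prod.distrib)
    moreover have "(\<Prod>y\<in>K-{0}. y) \<noteq> 0" using fin by simp
    ultimately have "x ^ card (K - {0}) = 1" by simp
    moreover have "card (K - {0}) = n - 1" using assms(4,5) by simp
    ultimately have "x ^ (n - 1) = 1" by simp
    then show ?thesis using n0 by (metis mult.right_neutral power_eq_if not_gr_zero)
  qed (use n0 in simp)
  then have "K \<subseteq> subfield_of_order n" by (auto simp: subfield_of_order_def)
  moreover have c: "card (subfield_of_order n :: 'k set) = n"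
    using card_subfield_of_order[OF assms(1-3)] .
  moreover have "finite (subfield_of_order n :: 'k set)"
    using c n0 by (intro card_ge_0_finite) simp
  ultimately show ?thesis using assms(4) by (simp add: card_subset_eq)
qed

section \<open>Abelian codes and duals\<close>

text \<open>
  The group algebra of \<open>'g\<close> over the field \<open>'k\<close> is the type \<open>'g \<Rightarrow>\<^sub>0 'k\<close>: addition is pointwise,
  multiplication is convolution, and the element \<open>c Y^g\<close> is \<open>Poly_Mapping.single g c\<close>.
  For a subfield \<open>K\<close> of \<open>'k\<close>, the group algebra over \<open>K\<close> is the following subring.
\<close>
definition group_algebra :: "'k::field set \<Rightarrow> ('g \<Rightarrow>\<^sub>0 'k) set" where
  "group_algebra K = {u. \<forall>g. Poly_Mapping.lookup u g \<in> K}"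

definition abelian_code :: "('g::{ab_group_add,finite} \<Rightarrow>\<^sub>0 'k::field) set \<Rightarrow> bool" where
  "abelian_code C \<longleftrightarrow>
     0 \<in> C \<and> (\<forall>u\<in>C. \<forall>v\<in>C. u + v \<in> C) \<and> (\<forall>w. \<forall>u\<in>C. w * u \<in> C)"

definition euclidean_ip :: "('g::finite \<Rightarrow>\<^sub>0 'k::field) \<Rightarrow> ('g \<Rightarrow>\<^sub>0 'k) \<Rightarrow> 'k" where
  "euclidean_ip u v = (\<Sum>g\<in>UNIV. Poly_Mapping.lookup u g * Poly_Mapping.lookup v g)"

definition euclidean_dual ::
    "'k::field set \<Rightarrow> ('g::finite \<Rightarrow>\<^sub>0 'k) set \<Rightarrow> ('g \<Rightarrow>\<^sub>0 'k) set" where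
  "euclidean_dual K C = {v \<in> group_algebra K. \<forall>c\<in>C. euclidean_ip c v = 0}"

text \<open>
  The Hermitian notions over \<open>K\<close> are meaningful when \<open>card K\<close> is a square \<open>Q\<^sup>2\<close>; the exponent
  \<open>Q\<close> is determined by \<open>K\<close>.
\<close>
definition hermitian_exponent :: "'k::field set \<Rightarrow> nat" where
  "hermitian_exponent K = (THE Q. Q ^ 2 = card K)"

lemma hermitian_exponent_eqI: "card K = Q ^ 2 \<Longrightarrow> hermitian_exponent K = Q"
  unfolding hermitian_exponent_def by (rule the_equality) auto

definition hermitian_ip ::
    "'k::field set \<Rightarrow> ('g::finite \<Rightarrow>\<^sub>0 'k) \<Rightarrow> ('g \<Rightarrow>\<^sub>0 'k) \<Rightarrow> 'k" where
  "hermitian_ip K u v =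
     (\<Sum>g\<in>UNIV. Poly_Mapping.lookup u g * Poly_Mapping.lookup v g ^ hermitian_exponent K)"

definition hermitian_dual ::
    "'k::field set \<Rightarrow> ('g::finite \<Rightarrow>\<^sub>0 'k) set \<Rightarrow> ('g \<Rightarrow>\<^sub>0 'k) set" where
  "hermitian_dual K C = {v \<in> group_algebra K. \<forall>c\<in>C. hermitian_ip K c v = 0}"

definition hermitian_complementary_dual ::
    "'k::field set \<Rightarrow> ('g::finite \<Rightarrow>\<^sub>0 'k) set \<Rightarrow> bool" where
  "hermitian_complementary_dual K C \<longleftrightarrow> C \<inter> hermitian_dual K C = {0}"

section \<open>Cyclotomic classes\<close>

definition nat_mult :: "nat \<Rightarrow> 'a::ab_group_add \<Rightarrow> 'a" where
  "nat_mult n a = (\<Sum>i<n. a)"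

definition cyclotomic_class :: "nat \<Rightarrow> 'a::ab_group_add \<Rightarrow> 'a set" where
  "cyclotomic_class q a = {nat_mult (q ^ i) a | i. True}"

definition type_I' :: "nat \<Rightarrow> nat \<Rightarrow> 'a::ab_group_add \<Rightarrow> bool" where
  "type_I' p \<nu> a \<longleftrightarrow>
     cyclotomic_class (p ^ (2 * \<nu>)) a = cyclotomic_class (p ^ (2 * \<nu>)) (- nat_mult (p ^ \<nu>) a)"

text \<open>
  \<open>rep 1, \<dots>, rep (r1 + 2 * r2)\<close> represent each class exactly once, in the order: the \<open>r1\<close> classes
  of type \<open>I'\<close>, then one class of each of the \<open>r2\<close> pairs of type \<open>II'\<close>, then their partners.
\<close>
definition class_representatives ::
    "nat \<Rightarrow> nat \<Rightarrow> nat \<Rightarrow> nat \<Rightarrow> (nat \<Rightarrow> 'a::ab_group_add) \<Rightarrow> bool" where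
  "class_representatives p \<nu> r1 r2 rep \<longleftrightarrow>
     bij_betw (\<lambda>i. cyclotomic_class (p ^ (2 * \<nu>)) (rep i)) {1..r1 + 2 * r2}
       (range (cyclotomic_class (p ^ (2 * \<nu>)))) \<and>
     (\<forall>j\<in>{1..r1}. type_I' p \<nu> (rep j)) \<and>
     (\<forall>l\<in>{1..r2}. \<not> type_I' p \<nu> (rep (r1 + l)) \<and>
        rep (r1 + r2 + l) = - nat_mult (p ^ \<nu>) (rep (r1 + l)))"

section \<open>The Fourier decomposition\<close>

definition characters :: "('a::ab_group_add \<Rightarrow> 'k::field) set" where
  "characters = {\<chi>. (\<forall>g. \<chi> g \<noteq> 0) \<and> (\<forall>g h. \<chi> (g + h) = \<chi> g * \<chi> h)}"

definition character_iso :: "('a::ab_group_add \<Rightarrow> 'a \<Rightarrow> 'k::field) \<Rightarrow> bool" where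
  "character_iso \<psi> \<longleftrightarrow>
     bij_betw \<psi> UNIV characters \<and> (\<forall>a b. \<psi> (a + b) = (\<lambda>h. \<psi> a h * \<psi> b h))"

definition fourier_field :: "nat \<Rightarrow> nat \<Rightarrow> 'a::ab_group_add \<Rightarrow> 'k::field set" where
  "fourier_field p \<nu> a =
     subfield_of_order (p ^ (2 * \<nu> * card (cyclotomic_class (p ^ (2 * \<nu>)) a)))"

text \<open>
  For \<open>'f\<close> of order \<open>p^(2 \<nu>)\<close> and \<open>\<psi>\<close> a group isomorphism onto the characters, both maps take
  values in \<open>group_algebra (fourier_field p \<nu> a)\<close>.
\<close>
definition fourier ::
    "('a::{ab_group_add,finite} \<Rightarrow> 'a \<Rightarrow> 'f::field alg_closure) \<Rightarrow> 'a \<Rightarrow>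
     ('a \<times> 'b::{ab_group_add,finite} \<Rightarrow>\<^sub>0 'f) \<Rightarrow> ('b \<Rightarrow>\<^sub>0 'f alg_closure)" where
  "fourier \<psi> a u =
     (\<Sum>b\<in>UNIV. Poly_Mapping.single b
        (\<Sum>h\<in>UNIV. to_ac (Poly_Mapping.lookup u (h, b)) * \<psi> a h))"

definition fourier' ::
    "nat \<Rightarrow> nat \<Rightarrow> ('a::{ab_group_add,finite} \<Rightarrow> 'a \<Rightarrow> 'f::field alg_closure) \<Rightarrow> 'a \<Rightarrow>
     ('a \<times> 'b::{ab_group_add,finite} \<Rightarrow>\<^sub>0 'f) \<Rightarrow> ('b \<Rightarrow>\<^sub>0 'f alg_closure)" where
  "fourier' p \<nu> \<psi> a u =
     (\<Sum>b\<in>UNIV. Poly_Mapping.single b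
        (\<Sum>h\<in>UNIV. to_ac (Poly_Mapping.lookup u (h, b) ^ (p ^ \<nu>)) * \<psi> (- a) h))"

end

theory Submission
  imports
    Defs
    "HOL-Number_Theory.Residues"
    "HOL-Combinatorics.Cycles"
    "HOL-Analysis.Cartesian_Space"
begin

text \<open>
  Put \<open>X_a(c, v) = \<langle>\<Phi>_a(c), \<Phi>'_a(v)\<rangle>\<^sub>E\<close>. As a function of \<open>a\<close> this is the Fourier transform of
  \<open>x \<mapsto> \<langle>Y^(-x) c, v\<rangle>\<^sub>H\<close>, so for an ideal \<open>C\<close> a vector \<open>v\<close> lies in the Hermitian dual iff all
  \<open>X_a(c, v)\<close> with \<open>c \<in> C\<close> vanish. Call \<open>C\<close> nondegenerate at \<open>a\<close> if \<open>\<Phi>'_a(v) = 0\<close> for every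
  \<open>v \<in> C\<close> with \<open>X_a(c, v) = 0\<close> for all \<open>c \<in> C\<close>. Fourier inversion shows that an ideal which is
  nondegenerate everywhere is Hermitian complementary dual; for the converse, multiply \<open>v\<close> by the
  idempotent of the class of \<open>-p^\<nu> a\<close> to kill the pairings outside the class of \<open>a\<close>.
  Nondegeneracy depends only on the class of \<open>a\<close>. If that class has type \<open>I'\<close>, then \<open>\<Phi>'_a\<close> is \<open>\<Phi>_a\<close>
  followed by the Hermitian conjugation of the coefficient field, and nondegeneracy at \<open>a\<close> says that
  \<open>\<Phi>_a(C)\<close> is Hermitian complementary dual. In general, nondegeneracy at \<open>a\<close> and at \<open>-p^\<nu> a\<close> are the
  two trivial intersection conditions on \<open>D = \<Phi>_a(C)\<close> and \<open>D' = \<Phi>'_a(C)\<close>.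
\<close>

section \<open>Translations in the group algebra and multiples in an abelian group\<close>

lemma lookup_single_times:
  fixes u :: "'g::ab_group_add \<Rightarrow>\<^sub>0 'k::semiring_0"
  shows "Poly_Mapping.lookup (Poly_Mapping.single g k * u) x = k * Poly_Mapping.lookup u (x - g)"
proof -
  have eq: "x = l + y \<longleftrightarrow> x - l = y" for l y :: 'g
    by (auto simp: algebra_simps)
  show ?thesis
    by (simp add: lookup_mult lookup_single eq when_mult)
qed

lemma nat_mult_0_left [simp]: "nat_mult 0 a = 0"
  and nat_mult_Suc: "nat_mult (Suc n) a = a + nat_mult n a"
  by (simp_all add: nat_mult_def add.commute)

lemma nat_mult_1 [simp]: "nat_mult (Suc 0) a = a"
  by (simp add: nat_mult_Suc)

lemma nat_mult_uminus: "nat_mult n (- a) = - nat_mult n a"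
  by (simp add: nat_mult_def sum_negf)

lemma nat_mult_add_left: "nat_mult (m + n) a = nat_mult m a + nat_mult n a"
  by (induction m) (simp_all add: nat_mult_Suc add.assoc)

lemma nat_mult_mult: "nat_mult (m * n) a = nat_mult m (nat_mult n a)"
  by (induction m) (simp_all add: nat_mult_Suc nat_mult_add_left)

lemma funpow_nat_mult: "(nat_mult n ^^ i) a = nat_mult (n ^ i) a"
  by (induction i) (simp_all add: nat_mult_mult)

lemma cyclotomic_class_eq_funpow: "cyclotomic_class n a = {(nat_mult n ^^ i) a |i. True}"
  by (simp add: cyclotomic_class_def funpow_nat_mult)

lemma self_in_cyclotomic_class: "a \<in> cyclotomic_class n a"
  unfolding cyclotomic_class_eq_funpow by (auto intro: exI[of _ 0])

lemma power_power_fixed: "(x :: 'k::monoid_mult) ^ n = x \<Longrightarrow> x ^ (n ^ i) = x"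
  by (induction i) (simp_all add: power_mult)

locale code_fourier =
  fixes p \<nu> :: nat
    and \<psi> :: "'a::{ab_group_add,finite} \<Rightarrow> 'a \<Rightarrow> 'f::finite_field alg_closure"
  assumes prime_p: "prime p" and \<nu>_pos: "\<nu> > 0"
    and card_field: "CARD('f) = p ^ (2 * \<nu>)"
    and not_dvd_card: "\<not> p dvd CARD('a)"
    and char_iso: "character_iso \<psi>"
begin

subsection \<open>Characters\<close>

lemma CHAR_eq: "CHAR('f) = p"
proof -
  have "CHAR('f) dvd p ^ (2 * \<nu>)"
    using CHAR_dvd_CARD[where 'a = 'f] card_field by simp
  then have "CHAR('f) dvd p"
    by (rule prime_dvd_power_nat[rotated]) simp
  then show ?thesis
    using prime_p by (simp add: primes_dvd_imp_eq)
qed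

lemma frobenius_sum:
  "(\<Sum>x\<in>S. f x :: 'f alg_closure) ^ (p ^ n) = (\<Sum>x\<in>S. f x ^ (p ^ n))"
  by (rule freshmans_dream_sum') (simp_all add: CHAR_eq prime_p)

text \<open>The power map is additive in characteristic \<open>p\<close>, and a field has no
  nilpotents. It serves to cancel Frobenius powers.\<close>

lemma frobenius_eq_iff: "(x :: 'f alg_closure) ^ (p ^ n) = y ^ (p ^ n) \<longleftrightarrow> x = y"
proof
  assume "x ^ (p ^ n) = y ^ (p ^ n)"
  moreover have "((x - y) + y) ^ (p ^ n) = (x - y) ^ (p ^ n) + y ^ (p ^ n)"
    by (rule freshmans_dream') (simp_all add: CHAR_eq prime_p)
  ultimately show "x = y" by simp
qed simp

lemma p_pos [simp]: "p > 0"
  using prime_p by (simp add: prime_gt_0_nat)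

text \<open>The image of \<open>'f\<close> is a subfield, and the only one of its order. Used in
  both directions: coefficients are fixed by the power, and fixed elements descend to
  \<open>'f\<close>.\<close>

lemma range_to_ac: "range (to_ac :: 'f \<Rightarrow> _) = {x. x ^ (p ^ (2 * \<nu>)) = x}"
proof -
  have "range (to_ac :: 'f \<Rightarrow> _) = subfield_of_order (p ^ (2 * \<nu>))"
  proof (rule subfield_of_order_unique[where m = "2 * \<nu>"])
    show "card (range (to_ac :: 'f \<Rightarrow> _)) = p ^ (2 * \<nu>)"
      by (simp add: card_image inj_to_ac card_field)
    show "0 \<in> range (to_ac :: 'f \<Rightarrow> _)"
      by (rule range_eqI[of _ _ 0]) simp
    show "x * y \<in> range (to_ac :: 'f \<Rightarrow> _)" if "x \<in> range to_ac" "y \<in> range to_ac" for x y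
      using that by (auto simp flip: to_ac_mult)
    show "inverse x \<in> range (to_ac :: 'f \<Rightarrow> _)" if "x \<in> range to_ac" for x
      using that by (auto simp flip: to_ac_inverse)
  qed (use \<nu>_pos in \<open>simp_all add: CHAR_eq prime_p\<close>)
  then show ?thesis by (simp add: subfield_of_order_def)
qed

lemma to_ac_frobenius: "to_ac (c :: 'f) ^ (p ^ (2 * \<nu>)) = to_ac c"
  using range_to_ac by blast

lemma psi_character: "\<psi> a \<in> characters"
  using char_iso by (auto simp: character_iso_def bij_betw_def)

lemma psi_nonzero [simp]: "\<psi> a h \<noteq> 0"
  and psi_add_right: "\<psi> a (g + h) = \<psi> a g * \<psi> a h"
  using psi_character[of a] by (auto simp: characters_def)

lemma psi_add_left: "\<psi> (a + b) h = \<psi> a h * \<psi> b h"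
  using char_iso by (simp add: character_iso_def)

lemma psi_eqI: "(\<And>h. \<psi> a h = \<psi> b h) \<Longrightarrow> a = b"
  using char_iso unfolding character_iso_def bij_betw_def by (metis ext injD)

lemma psi_0_left [simp]: "\<psi> 0 h = 1"
  using psi_add_left[of 0 0 h] by simp

lemma psi_0_right [simp]: "\<psi> a 0 = 1"
  using psi_add_right[of a 0 0] by simp

lemma psi_minus_left: "\<psi> (- a) h = inverse (\<psi> a h)"
  using psi_add_left[of a "- a" h] by (simp add: inverse_unique)

lemma psi_minus_right: "\<psi> a (- h) = inverse (\<psi> a h)"
  using psi_add_right[of a h "- h"] by (simp add: inverse_unique)

lemma psi_diff_right: "\<psi> a (g - h) = \<psi> a g * inverse (\<psi> a h)"
  using psi_add_right[of a g "- h"] psi_minus_right by simp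

lemma psi_nat_mult: "\<psi> (nat_mult n a) h = \<psi> a h ^ n"
  by (induction n) (simp_all add: nat_mult_Suc psi_add_left)

text \<open>Under \<open>\<psi>\<close> this map becomes a Frobenius power of the character values,
  which is injective.\<close>

lemma inj_nat_mult: "inj (nat_mult (p ^ n) :: 'a \<Rightarrow> 'a)"
proof (rule injI)
  fix a b :: 'a
  assume "nat_mult (p ^ n) a = nat_mult (p ^ n) b"
  then have "\<psi> a h ^ (p ^ n) = \<psi> b h ^ (p ^ n)" for h
    using psi_nat_mult by metis
  then show "a = b" by (intro psi_eqI) (simp add: frobenius_eq_iff)
qed

text \<open>A nontrivial character has a value other than 1 at some \<open>g\<close>; shifting the
  summation variable by \<open>g\<close> multiplies the sum by that value.\<close>

lemma sum_psi: "(\<Sum>x\<in>UNIV. \<psi> a x) = (if a = 0 then of_nat CARD('a) else 0)"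
proof (cases "a = 0")
  case False
  then obtain g where g: "\<psi> a g \<noteq> 1"
    using psi_eqI[of a 0] by auto
  have "(\<Sum>x\<in>UNIV. \<psi> a x) = (\<Sum>x\<in>UNIV. \<psi> a (g + x))"
    by (rule sum.reindex_bij_witness[of _ "\<lambda>x. g + x" "\<lambda>x. x - g"]) auto
  also have "\<dots> = \<psi> a g * (\<Sum>x\<in>UNIV. \<psi> a x)"
    by (simp add: psi_add_right sum_distrib_left)
  finally show ?thesis using g False by simp
qed simp

lemma card_nonzero: "(of_nat CARD('a) :: 'f alg_closure) \<noteq> 0"
  using not_dvd_card CHAR_eq by (simp add: of_nat_eq_0_iff_char_dvd)

lemma psi_orthogonal:
  "(\<Sum>x\<in>UNIV. \<psi> a x * \<psi> (- b) x) = (if a = b then of_nat CARD('a) else 0)"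
  using sum_psi[of "a - b"] psi_add_left[of a "- b"] by simp

text \<open>Orthogonality gives a one-sided inverse \<open>N\<close> of the character matrix
  \<open>M\<close>. For square matrices it is two-sided, so \<open>M\<close> has trivial
  kernel.\<close>

lemma fourier_inversion:
  fixes f :: "'a \<Rightarrow> 'f alg_closure"
  assumes "\<And>a. (\<Sum>x\<in>UNIV. \<psi> a x * f x) = 0"
  shows "f x = 0"
proof -
  define M :: "(('f alg_closure, 'a) vec, 'a) vec" where "M = (\<chi> a x. \<psi> a x)"
  define N :: "(('f alg_closure, 'a) vec, 'a) vec" where
    "N = (\<chi> x a. \<psi> (- a) x / of_nat CARD('a))"
  have "M ** N = mat 1"
    using psi_orthogonal card_nonzero
    by (simp add: vec_eq_iff matrix_matrix_mult_def M_def N_def mat_def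
        flip: sum_divide_distrib)
  then have "N ** M = mat 1"
    using matrix_left_right_inverse by blast
  moreover have "M *v (\<chi> x. f x) = 0"
    using assms by (simp add: vec_eq_iff matrix_vector_mult_def M_def)
  ultimately have "(\<chi> x. f x) = 0"
    by (metis matrix_vector_mul_assoc matrix_vector_mul_lid matrix_vector_mult_0_right)
  then show ?thesis by (simp add: vec_eq_iff)
qed

subsection \<open>Cyclotomic classes\<close>

abbreviation step :: "'a \<Rightarrow> 'a" where "step \<equiv> nat_mult (p ^ (2 * \<nu>))"

abbreviation conjugate :: "'a \<Rightarrow> 'a" where "conjugate a \<equiv> - nat_mult (p ^ \<nu>) a"

lemma conjugate_conjugate: "conjugate (conjugate a) = step a"
  by (simp add: nat_mult_uminus mult_2 power_add nat_mult_mult)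

lemma conjugate_step: "conjugate (step a) = step (conjugate a)"
  by (metis nat_mult_mult nat_mult_uminus mult.commute)

lemma conjugate_funpow_step: "conjugate ((step ^^ i) a) = (step ^^ i) (conjugate a)"
  by (induction i) (simp_all add: conjugate_step)

lemma conjugate_eq_iff: "conjugate a = conjugate b \<longleftrightarrow> a = b"
  using inj_nat_mult by (simp add: inj_eq)

lemma permutation_step: "permutation step"
  unfolding permutation using inj_nat_mult by (simp add: finite_UNIV_inj_surj bij_def)

text \<open>Since \<open>step\<close> is a permutation of a finite set, the forward orbit is a full
  cycle, whose length is the least period of \<open>a\<close>.\<close>

lemma
  shows least_power_step: "least_power step a = card (cyclotomic_class (p ^ (2 * \<nu>)) a)"
    and step_image_class:
      "step ` cyclotomic_class (p ^ (2 * \<nu>)) a = cyclotomic_class (p ^ (2 * \<nu>)) a"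
proof -
  have "cyclotomic_class (p ^ (2 * \<nu>)) a = set (support step a)"
    unfolding cyclotomic_class_eq_funpow support_set[OF permutation_step] by auto
  moreover have "distinct (support step a)"
    using cycle_of_permutation[OF permutation_step] .
  ultimately show "least_power step a = card (cyclotomic_class (p ^ (2 * \<nu>)) a)"
    by (metis distinct_card length_map length_upt minus_nat.diff_0)
  have "step ` cyclotomic_class (p ^ (2 * \<nu>)) a \<subseteq> cyclotomic_class (p ^ (2 * \<nu>)) a"
    unfolding cyclotomic_class_eq_funpow by (force intro: exI[of _ "Suc _"])
  moreover have "inj_on step (cyclotomic_class (p ^ (2 * \<nu>)) a)"
    using inj_nat_mult by (rule inj_on_subset) simp
  ultimately show "step ` cyclotomic_class (p ^ (2 * \<nu>)) a = cyclotomic_class (p ^ (2 * \<nu>)) a"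
    by (intro endo_inj_surj) simp_all
qed

lemma funpow_class_card: "(step ^^ card (cyclotomic_class (p ^ (2 * \<nu>)) a)) a = a"
  using least_power_of_permutation(1)[OF permutation_step] least_power_step by metis

text \<open>
  For a class of type \<open>I'\<close> the size \<open>s\<close> is odd: writing \<open>-p^\<nu> a = p^(2\<nu>i) a\<close> and applying this
  twice gives \<open>p^(2\<nu>(2i - 1)) a = a\<close>, so that \<open>s\<close> divides \<open>2i - 1\<close>.
\<close>
lemma type_I'_exponent:
  assumes "type_I' p \<nu> a"
  obtains i k where "conjugate a = (step ^^ i) a"
    and "2 * i = card (cyclotomic_class (p ^ (2 * \<nu>)) a) * (2 * k + 1) + 1"
proof -
  define s where "s = card (cyclotomic_class (p ^ (2 * \<nu>)) a)"
  have s_pos: "s > 0"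
    unfolding s_def least_power_step[symmetric] by (rule least_power_of_permutation[OF permutation_step])
  have "conjugate a \<in> cyclotomic_class (p ^ (2 * \<nu>)) a"
    using assms self_in_cyclotomic_class unfolding type_I'_def by metis
  then obtain i0 where i0: "conjugate a = (step ^^ i0) a"
    unfolding cyclotomic_class_eq_funpow by auto
  \<comment> \<open>Adding a full period changes nothing at \<open>a\<close> but makes
    \<open>i\<close> positive, so that \<open>2 * i - 1\<close> is not a truncated
    difference.\<close>
  define i where "i = i0 + s"
  have i: "conjugate a = (step ^^ i) a"
    using i0 funpow_class_card[of a] by (simp add: i_def s_def funpow_add)
  have "step a = conjugate ((step ^^ i) a)"
    using i conjugate_conjugate by metis
  also have "\<dots> = (step ^^ (i + i)) a"
    by (simp only: conjugate_funpow_step i funpow_add o_apply)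
  also have "\<dots> = step ((step ^^ (2 * i - 1)) a)"
    using s_pos by (metis Suc_diff_1 add_gr_0 comp_apply funpow.simps(2) i_def mult_2)
  finally have "(step ^^ (2 * i - 1)) a = a"
    using inj_nat_mult by (metis injD)
  then have "s dvd 2 * i - 1"
    using least_power_minimal[of "2 * i - 1" step a] least_power_step by (simp add: s_def)
  then obtain m where m: "2 * i - 1 = s * m" by (elim dvdE)
  have odd: "odd (2 * i - 1)" using s_pos by (simp add: i_def)
  then have "odd m" using m by (metis even_mult_iff)
  then obtain k where "m = 2 * k + 1" by (elim oddE)
  then have "2 * i = s * (2 * k + 1) + 1"
    using m s_pos by (simp add: i_def)
  then show thesis by (intro that[OF i]) (simp only: s_def)
qed

subsection \<open>Fourier transforms\<close>

lemma lookup_fourier: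
  "Poly_Mapping.lookup (fourier \<psi> a u) b =
     (\<Sum>h\<in>UNIV. to_ac (Poly_Mapping.lookup u (h, b)) * \<psi> a h)"
  by (simp add: fourier_def lookup_sum lookup_single when_def)

lemma lookup_fourier':
  "Poly_Mapping.lookup (fourier' p \<nu> \<psi> a u) b =
     (\<Sum>h\<in>UNIV. to_ac (Poly_Mapping.lookup u (h, b)) ^ (p ^ \<nu>) * \<psi> (- a) h)"
  by (simp add: fourier'_def lookup_sum lookup_single when_def)

text \<open>The coefficients of \<open>u\<close> are fixed by this power; only the character values
  change.\<close>

lemma lookup_fourier_step:
  "Poly_Mapping.lookup (fourier \<psi> (step a) u) b =
     Poly_Mapping.lookup (fourier \<psi> a u) b ^ (p ^ (2 * \<nu>))"
  by (simp add: lookup_fourier frobenius_sum power_mult_distrib to_ac_frobenius psi_nat_mult)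

text \<open>Two powers by \<open>p ^ \<nu>\<close> restore the coefficients, while the character
  index \<open>- a\<close> becomes \<open>conjugate a\<close>.\<close>

lemma lookup_fourier_conj:
  "Poly_Mapping.lookup (fourier \<psi> (conjugate a) u) b =
     Poly_Mapping.lookup (fourier' p \<nu> \<psi> a u) b ^ (p ^ \<nu>)"
proof -
  have "to_ac (c :: 'f) ^ (p ^ \<nu> * p ^ \<nu>) = to_ac c" for c
    using to_ac_frobenius[of c] by (simp add: mult_2 power_add)
  then show ?thesis
    by (simp add: lookup_fourier lookup_fourier' frobenius_sum power_mult_distrib
        psi_nat_mult flip: power_mult nat_mult_uminus)
qed

lemma lookup_fourier'_conj:
  "Poly_Mapping.lookup (fourier' p \<nu> \<psi> (conjugate a) u) b =
     Poly_Mapping.lookup (fourier \<psi> a u) b ^ (p ^ \<nu>)"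
  by (simp add: lookup_fourier lookup_fourier' frobenius_sum power_mult_distrib psi_nat_mult)

lemma lookup_fourier'_step:
  "Poly_Mapping.lookup (fourier' p \<nu> \<psi> (step a) u) b =
     Poly_Mapping.lookup (fourier' p \<nu> \<psi> a u) b ^ (p ^ (2 * \<nu>))"
  unfolding conjugate_conjugate[symmetric]
  by (simp only: lookup_fourier'_conj lookup_fourier_conj mult_2 power_add flip: power_mult)

lemma lookup_fourier_funpow:
  "Poly_Mapping.lookup (fourier \<psi> ((step ^^ i) a) u) b =
     Poly_Mapping.lookup (fourier \<psi> a u) b ^ (p ^ (2 * \<nu>)) ^ i"
proof (induction i)
  case (Suc i)
  then show ?case
    by (simp only: funpow.simps(2) o_apply lookup_fourier_step power_Suc2
        power_mult[of "Poly_Mapping.lookup (fourier \<psi> a u) b"])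
qed simp

lemma fourier'_eq_0_iff: "fourier' p \<nu> \<psi> a u = 0 \<longleftrightarrow> fourier \<psi> (conjugate a) u = 0"
  by (simp add: poly_mapping_eq_iff fun_eq_iff lookup_fourier_conj)

lemma fourier'_conj_eq_0_iff: "fourier' p \<nu> \<psi> (conjugate a) u = 0 \<longleftrightarrow> fourier \<psi> a u = 0"
  by (simp add: poly_mapping_eq_iff fun_eq_iff lookup_fourier'_conj)

lemma fourier_0 [simp]: "fourier \<psi> a 0 = 0"
  by (simp add: poly_mapping_eq_iff fun_eq_iff lookup_fourier)

lemma fourier'_0 [simp]: "fourier' p \<nu> \<psi> a 0 = 0"
  by (simp add: fourier'_eq_0_iff)

lemma fourier_eq_0_imp:
  assumes "\<And>a. fourier \<psi> a u = 0"
  shows "u = 0"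
proof -
  have "to_ac (Poly_Mapping.lookup u (h, b)) = 0" for h b
  proof (rule fourier_inversion)
    show "(\<Sum>h\<in>UNIV. \<psi> a h * to_ac (Poly_Mapping.lookup u (h, b))) = 0" for a
      using assms[of a] lookup_fourier[of a u b] by (simp add: mult.commute)
  qed
  then show ?thesis by (auto simp: poly_mapping_eq_iff fun_eq_iff)
qed

lemma fourier'_eq_0_imp:
  assumes "\<And>a. fourier' p \<nu> \<psi> a u = 0"
  shows "u = 0"
  using assms fourier'_conj_eq_0_iff by (metis fourier_eq_0_imp)

section \<open>Coefficient fields of the transforms\<close>

lemma card_fourier_field: "card (fourier_field p \<nu> (a :: 'a) :: 'f alg_closure set) =
    (p ^ (\<nu> * card (cyclotomic_class (p ^ (2 * \<nu>)) a)))\<^sup>2"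
proof -
  have "card (cyclotomic_class (p ^ (2 * \<nu>)) a) > 0"
    using self_in_cyclotomic_class[of a] by (auto simp: card_gt_0_iff)
  then have "card (fourier_field p \<nu> a :: 'f alg_closure set) =
      p ^ (2 * \<nu> * card (cyclotomic_class (p ^ (2 * \<nu>)) a))"
    unfolding fourier_field_def using \<nu>_pos
    by (intro card_subfield_of_order[where
           m = "2 * \<nu> * card (cyclotomic_class (p ^ (2 * \<nu>)) a)"]) (simp_all add: CHAR_eq prime_p)
  then show ?thesis by (simp add: mult_ac flip: power_mult)
qed

text \<open>After as many steps as the class has elements, \<open>a\<close> returns to itself, so
  the accumulated Frobenius power fixes the value.\<close>

lemma lookup_fourier_in_field:
  "Poly_Mapping.lookup (fourier \<psi> a u) b ^
     (p ^ (2 * \<nu> * card (cyclotomic_class (p ^ (2 * \<nu>)) a))) =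
   Poly_Mapping.lookup (fourier \<psi> a u) b"
  using lookup_fourier_funpow[of "card (cyclotomic_class (p ^ (2 * \<nu>)) a)" a u b]
  by (simp only: funpow_class_card power_mult[of p "2 * \<nu>"])

lemma fourier_in_group_algebra: "fourier \<psi> a u \<in> group_algebra (fourier_field p \<nu> a)"
  by (simp add: group_algebra_def fourier_field_def subfield_of_order_def lookup_fourier_in_field)

lemma fourier'_in_group_algebra: "fourier' p \<nu> \<psi> a u \<in> group_algebra (fourier_field p \<nu> a)"
proof -
  define s where "s = card (cyclotomic_class (p ^ (2 * \<nu>)) a)"
  have "(step ^^ s) (conjugate a) = conjugate a"
    using funpow_class_card[of a] by (simp add: s_def flip: conjugate_funpow_step)
  then have "(Poly_Mapping.lookup (fourier' p \<nu> \<psi> a u) b ^ (p ^ \<nu>)) ^ (p ^ (2 * \<nu> * s)) =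
      Poly_Mapping.lookup (fourier' p \<nu> \<psi> a u) b ^ (p ^ \<nu>)" for b
    using lookup_fourier_funpow[of s "conjugate a" u b]
    by (simp only: lookup_fourier_conj power_mult[of p "2 * \<nu>" s])
  \<comment> \<open>The two powers commute; with the injective one outermost, it can be
    cancelled.\<close>
  then have "(Poly_Mapping.lookup (fourier' p \<nu> \<psi> a u) b ^ (p ^ (2 * \<nu> * s))) ^ (p ^ \<nu>) =
      Poly_Mapping.lookup (fourier' p \<nu> \<psi> a u) b ^ (p ^ \<nu>)" for b
    by (simp only: mult.commute flip: power_mult)
  then show ?thesis
    by (simp only: frobenius_eq_iff group_algebra_def fourier_field_def subfield_of_order_def
        s_def mem_Collect_eq simp_thms)
qed

lemma lookup_fourier'_type_I':
  assumes "type_I' p \<nu> a"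
  shows "Poly_Mapping.lookup (fourier' p \<nu> \<psi> a u) b =
    Poly_Mapping.lookup (fourier \<psi> a u) b ^
      hermitian_exponent (fourier_field p \<nu> a :: 'f alg_closure set)"
proof -
  define s where "s = card (cyclotomic_class (p ^ (2 * \<nu>)) a)"
  define x where "x = Poly_Mapping.lookup (fourier \<psi> a u) b"
  obtain i k where i: "conjugate a = (step ^^ i) a" and ik: "2 * i = s * (2 * k + 1) + 1"
    using type_I'_exponent[OF assms] unfolding s_def by blast
  \<comment> \<open>The summands stand for \<open>k\<close> full Frobenius periods that fix
    \<open>x\<close>, the Hermitian conjugation of the coefficient field, and the power
    \<open>p ^ \<nu>\<close> to be cancelled.\<close>
  have e: "2 * \<nu> * i = 2 * \<nu> * s * k + \<nu> * s + \<nu>"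
  proof -
    have "2 * \<nu> * i = \<nu> * (2 * i)" by simp
    then show ?thesis unfolding ik by (simp add: algebra_simps)
  qed
  have "Poly_Mapping.lookup (fourier' p \<nu> \<psi> a u) b ^ (p ^ \<nu>) = x ^ (p ^ (2 * \<nu> * i))"
    using lookup_fourier_conj[of a u b] lookup_fourier_funpow[of i a u b] i
    by (simp add: x_def power_mult)
  also have "\<dots> = ((x ^ ((p ^ (2 * \<nu> * s)) ^ k)) ^ (p ^ (\<nu> * s))) ^ (p ^ \<nu>)"
    by (simp only: e power_add power_mult)
  also have "x ^ ((p ^ (2 * \<nu> * s)) ^ k) = x"
    using lookup_fourier_in_field[of a u b] by (intro power_power_fixed[of x "p ^ (2 * \<nu> * s)" k]) (simp add: x_def s_def)
  finally have "Poly_Mapping.lookup (fourier' p \<nu> \<psi> a u) b = x ^ (p ^ (\<nu> * s))"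
    by (simp only: frobenius_eq_iff)
  then show ?thesis
    using hermitian_exponent_eqI[OF card_fourier_field[of a]] by (simp add: x_def s_def)
qed

section \<open>Multipliers supported on the first factor, and class idempotents\<close>

lemma lookup_fourier_single_sum_times:
  "Poly_Mapping.lookup (fourier \<psi> a ((\<Sum>h\<in>UNIV. Poly_Mapping.single (h, 0) (e h)) * u)) b =
     (\<Sum>h\<in>UNIV. to_ac (e h) * \<psi> a h) * Poly_Mapping.lookup (fourier \<psi> a u) b"
proof -
  let ?u = "\<lambda>h. to_ac (Poly_Mapping.lookup u (h, b))"
  \<comment> \<open>After the shift the character value splits into a factor for \<open>h\<close>
    and one for \<open>k\<close>, which separates the double sum.\<close>
  have reindex: "(\<Sum>k\<in>UNIV. to_ac (e h) * ?u (k - h) * \<psi> a k) =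
      (\<Sum>k\<in>UNIV. to_ac (e h) * ?u k * \<psi> a (k + h))" for h
    by (rule sum.reindex_bij_witness[of _ "\<lambda>k. k + h" "\<lambda>k. k - h"]) auto
  have "Poly_Mapping.lookup (fourier \<psi> a ((\<Sum>h\<in>UNIV. Poly_Mapping.single (h, 0) (e h)) * u)) b =
      (\<Sum>k\<in>UNIV. \<Sum>h\<in>UNIV. to_ac (e h) * ?u (k - h) * \<psi> a k)"
    by (simp add: lookup_fourier sum_distrib_right lookup_sum lookup_single_times to_ac_sum)
  also have "\<dots> = (\<Sum>h\<in>UNIV. \<Sum>k\<in>UNIV. to_ac (e h) * ?u (k - h) * \<psi> a k)"
    by (rule sum.swap)
  also have "\<dots> = (\<Sum>h\<in>UNIV. \<Sum>k\<in>UNIV. to_ac (e h) * ?u k * \<psi> a (k + h))"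
    by (simp only: reindex)
  finally show ?thesis
    by (simp add: lookup_fourier psi_add_right sum_product mult_ac)
qed

lemma projection_exists:
  fixes u :: "'a \<times> 'b::{ab_group_add,finite} \<Rightarrow>\<^sub>0 'f"
  obtains w :: "'a \<times> 'b \<Rightarrow>\<^sub>0 'f"
  where "\<And>d. fourier \<psi> d (w * u) =
    (if d \<in> cyclotomic_class (p ^ (2 * \<nu>)) a then fourier \<psi> d u else 0)"
proof -
  let ?S = "cyclotomic_class (p ^ (2 * \<nu>)) a"
  \<comment> \<open>The inverse transform of the indicator function of the class.\<close>
  define f where "f h = (\<Sum>d\<in>?S. \<psi> (- d) h) / of_nat CARD('a)" for h
  have "f h ^ (p ^ (2 * \<nu>)) = f h" for h
  proof -
    have "(of_nat CARD('a) :: 'f alg_closure) ^ (p ^ (2 * \<nu>)) = of_nat CARD('a)"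
      by (metis to_ac_frobenius to_ac_of_nat)
    moreover have "(\<Sum>d\<in>?S. \<psi> (- d) h) ^ (p ^ (2 * \<nu>)) = (\<Sum>d\<in>?S. \<psi> (- step d) h)"
      by (simp add: frobenius_sum psi_nat_mult flip: nat_mult_uminus)
    \<comment> \<open>As \<open>step\<close> permutes the class, the Frobenius power only rearranges
      the sum, so \<open>f h\<close> lies in the base field.\<close>
    moreover have "(\<Sum>d\<in>?S. \<psi> (- step d) h) = (\<Sum>d\<in>step ` ?S. \<psi> (- d) h)"
      by (subst sum.reindex) (auto intro: inj_on_subset[OF inj_nat_mult])
    ultimately show ?thesis
      by (simp add: f_def power_divide step_image_class)
  qed
  then have "\<forall>h. \<exists>c :: 'f. f h = to_ac c"
    using range_to_ac by blast
  then obtain e :: "'a \<Rightarrow> 'f" where e: "f h = to_ac (e h)" for h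
    by metis
  have ind: "(\<Sum>h\<in>UNIV. to_ac (e h) * \<psi> d h) = (if d \<in> ?S then 1 else 0)" for d
  proof -
    have "(\<Sum>h\<in>UNIV. to_ac (e h) * \<psi> d h) =
        (\<Sum>h\<in>UNIV. \<Sum>d'\<in>?S. \<psi> d h * \<psi> (- d') h) / of_nat CARD('a)"
      by (simp add: f_def sum_divide_distrib sum_distrib_left mult_ac flip: e)
    also have "(\<Sum>h\<in>UNIV. \<Sum>d'\<in>?S. \<psi> d h * \<psi> (- d') h) =
        (\<Sum>d'\<in>?S. \<Sum>h\<in>UNIV. \<psi> d h * \<psi> (- d') h)"
      by (rule sum.swap)
    also have "\<dots> = (\<Sum>d'\<in>?S. if d = d' then of_nat CARD('a) else 0)"
      by (simp only: psi_orthogonal)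
    also have "\<dots> / of_nat CARD('a) = (if d \<in> ?S then 1 else 0)"
      using card_nonzero by (simp add: sum.delta)
    finally show ?thesis .
  qed
  show thesis
    by (rule that[of "\<Sum>h\<in>UNIV. Poly_Mapping.single (h, 0) (e h)"])
      (simp add: poly_mapping_eq_iff fun_eq_iff lookup_fourier_single_sum_times ind)
qed

subsection \<open>The Hermitian dual in the frequency domain\<close>

definition pairing where
  "pairing a c v = euclidean_ip (fourier \<psi> a c) (fourier' p \<nu> \<psi> a v)"

lemma hermitian_exponent_UNIV: "hermitian_exponent (UNIV :: 'f set) = p ^ \<nu>"
  by (rule hermitian_exponent_eqI) (simp add: card_field mult.commute flip: power_mult)

text \<open>In the double sum over \<open>h\<close> and \<open>k\<close>, the product
  \<open>\<psi> a h * \<psi> (- a) k\<close> depends only on \<open>x = h - k\<close>, so the terms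
  are grouped by \<open>x\<close>.\<close>

lemma pairing_eq_transform:
  fixes c v :: "'a \<times> 'b::{ab_group_add,finite} \<Rightarrow>\<^sub>0 'f"
  shows "pairing a c v =
    (\<Sum>x\<in>UNIV. \<psi> a x * to_ac (hermitian_ip UNIV (Poly_Mapping.single (- x, 0) 1 * c) v))"
proof -
  define c' where "c' h b = to_ac (Poly_Mapping.lookup c (h, b))" for h b
  define v' where "v' h b = to_ac (Poly_Mapping.lookup v (h, b)) ^ (p ^ \<nu>)" for h b
  \<comment> \<open>Multiplication by the monomial at \<open>- x\<close> moves the coefficient at
    \<open>k + x\<close> to \<open>k\<close>.\<close>
  have ip: "(\<Sum>k\<in>UNIV. \<Sum>b\<in>UNIV. c' (k + x) b * v' k b) =
      to_ac (hermitian_ip UNIV (Poly_Mapping.single (- x, 0) 1 * c) v)" for x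
    by (simp add: hermitian_ip_def hermitian_exponent_UNIV to_ac_sum lookup_single_times
        c'_def v'_def sum.cartesian_product minus_prod_def case_prod_beta)
  have reindex: "(\<Sum>h\<in>UNIV. c' h b * \<psi> a h * (v' k b * \<psi> (- a) k)) =
      (\<Sum>x\<in>UNIV. \<psi> a x * (c' (k + x) b * v' k b))" for k b
    by (rule sum.reindex_bij_witness[of _ "\<lambda>x. k + x" "\<lambda>h. h - k"])
      (auto simp: psi_minus_left psi_diff_right mult_ac)
  have "pairing a c v =
      (\<Sum>b\<in>UNIV. (\<Sum>h\<in>UNIV. c' h b * \<psi> a h) * (\<Sum>k\<in>UNIV. v' k b * \<psi> (- a) k))"
    by (simp add: pairing_def euclidean_ip_def lookup_fourier lookup_fourier' c'_def v'_def)
  also have "\<dots> = (\<Sum>b\<in>UNIV. \<Sum>k\<in>UNIV. \<Sum>h\<in>UNIV. c' h b * \<psi> a h * (v' k b * \<psi> (- a) k))"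
    unfolding sum_product by (intro sum.cong refl sum.swap)
  also have "\<dots> = (\<Sum>b\<in>UNIV. \<Sum>k\<in>UNIV. \<Sum>x\<in>UNIV. \<psi> a x * (c' (k + x) b * v' k b))"
    by (simp only: reindex)
  also have "\<dots> = (\<Sum>b\<in>UNIV. \<Sum>x\<in>UNIV. \<Sum>k\<in>UNIV. \<psi> a x * (c' (k + x) b * v' k b))"
    by (intro sum.cong refl sum.swap)
  also have "\<dots> = (\<Sum>x\<in>UNIV. \<Sum>b\<in>UNIV. \<Sum>k\<in>UNIV. \<psi> a x * (c' (k + x) b * v' k b))"
    by (rule sum.swap)
  also have "\<dots> = (\<Sum>x\<in>UNIV. \<psi> a x * (\<Sum>k\<in>UNIV. \<Sum>b\<in>UNIV. c' (k + x) b * v' k b))"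
    by (subst sum.swap) (simp only: sum_distrib_left)
  also have "\<dots> =
      (\<Sum>x\<in>UNIV. \<psi> a x * to_ac (hermitian_ip UNIV (Poly_Mapping.single (- x, 0) 1 * c) v))"
    by (simp only: ip)
  finally show ?thesis .
qed

text \<open>An ideal contains all translates of its codewords, so orthogonality kills every term of
  the transform. The converse is Fourier inversion, evaluated at \<open>x = 0\<close>.\<close>

lemma hermitian_dual_iff_pairing:
  assumes "abelian_code C"
  shows "v \<in> hermitian_dual UNIV C \<longleftrightarrow> (\<forall>c\<in>C. \<forall>a. pairing a c v = 0)"
proof
  assume "v \<in> hermitian_dual UNIV C"
  then show "\<forall>c\<in>C. \<forall>a. pairing a c v = 0"
    using assms by (simp add: hermitian_dual_def abelian_code_def pairing_eq_transform)
next
  assume pairing: "\<forall>c\<in>C. \<forall>a. pairing a c v = 0"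
  have "hermitian_ip UNIV c v = 0" if "c \<in> C" for c
  proof -
    have "to_ac (hermitian_ip UNIV (Poly_Mapping.single (- x, 0) 1 * c) v) = 0" for x
      by (rule fourier_inversion[where f =
          "\<lambda>x. to_ac (hermitian_ip UNIV (Poly_Mapping.single (- x, 0) 1 * c) v)"])
        (use pairing that in \<open>simp flip: pairing_eq_transform\<close>)
    from this[of 0] show ?thesis by (simp flip: zero_prod_def)
  qed
  then show "v \<in> hermitian_dual UNIV C"
    by (simp add: hermitian_dual_def group_algebra_def)
qed

lemma pairing_step: "pairing (step a) c v = pairing a c v ^ (p ^ (2 * \<nu>))"
  by (simp add: pairing_def euclidean_ip_def frobenius_sum power_mult_distrib
      lookup_fourier_step lookup_fourier'_step)

lemma pairing_funpow_eq_0: "pairing a c v = 0 \<Longrightarrow> pairing ((step ^^ i) a) c v = 0"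
  by (induction i) (simp_all add: pairing_step)

text \<open>Conjugating the frequency exchanges the two transforms up to Frobenius. This turns
  nondegeneracy at the partner class into the second intersection condition.\<close>

lemma pairing_conj:
  "pairing (conjugate a) c v = euclidean_ip (fourier' p \<nu> \<psi> a c) (fourier \<psi> a v) ^ (p ^ \<nu>)"
  by (simp add: pairing_def euclidean_ip_def frobenius_sum power_mult_distrib
      lookup_fourier_conj lookup_fourier'_conj)

section \<open>Nondegeneracy at a frequency\<close>

definition nondegenerate_at where
  "nondegenerate_at C a \<longleftrightarrow>
     (\<forall>v\<in>C. (\<forall>c\<in>C. pairing a c v = 0) \<longrightarrow> fourier' p \<nu> \<psi> a v = 0)"

text \<open>A step replaces pairings and transforms by Frobenius powers, which vanish exactly when
  the originals do.\<close>

lemma nondegenerate_at_funpow: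
  fixes C :: "('a \<times> 'b::{ab_group_add,finite} \<Rightarrow>\<^sub>0 'f) set"
  assumes "nondegenerate_at C a"
  shows "nondegenerate_at C ((step ^^ i) a)"
proof (induction i)
  case (Suc i)
  define d where "d = (step ^^ i) a"
  have "fourier' p \<nu> \<psi> (step d) v = 0" if "fourier' p \<nu> \<psi> d v = 0"
    for v :: "'a \<times> 'b \<Rightarrow>\<^sub>0 'f"
    using that by (simp add: poly_mapping_eq_iff fun_eq_iff lookup_fourier'_step)
  moreover have "pairing (step d) c v = 0 \<longleftrightarrow> pairing d c v = 0"
    for c v :: "'a \<times> 'b \<Rightarrow>\<^sub>0 'f"
    by (simp add: pairing_step)
  ultimately show ?case
    using Suc by (simp add: nondegenerate_at_def flip: d_def)
qed (use assms in simp)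

lemma zero_in_hermitian_dual:
  "0 \<in> hermitian_dual UNIV (C :: ('a \<times> 'b::{ab_group_add,finite} \<Rightarrow>\<^sub>0 'f) set)"
  by (simp add: hermitian_dual_def group_algebra_def hermitian_ip_def hermitian_exponent_UNIV
      zero_power)

lemma hermitian_complementary_dual_iff_nondegenerate:
  fixes C :: "('a \<times> 'b::{ab_group_add,finite} \<Rightarrow>\<^sub>0 'f) set"
  assumes C: "abelian_code C"
  shows "hermitian_complementary_dual UNIV C \<longleftrightarrow> (\<forall>a. nondegenerate_at C a)"
proof
  assume nondeg: "\<forall>a. nondegenerate_at C a"
  have "v = 0" if "v \<in> C" "v \<in> hermitian_dual UNIV C" for v
    using nondeg that unfolding hermitian_dual_iff_pairing[OF C] nondegenerate_at_def
    by (intro fourier'_eq_0_imp) blast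
  then show "hermitian_complementary_dual UNIV C"
    using C zero_in_hermitian_dual
    by (auto simp: hermitian_complementary_dual_def abelian_code_def)
next
  assume hcd: "hermitian_complementary_dual UNIV C"
  show "\<forall>a. nondegenerate_at C a"
    unfolding nondegenerate_at_def
  proof (intro allI ballI impI)
    fix a v
    assume v: "v \<in> C" and pairing: "\<forall>c\<in>C. pairing a c v = 0"
    let ?S = "cyclotomic_class (p ^ (2 * \<nu>)) (conjugate a)"
    obtain w where w: "fourier \<psi> d (w * v) = (if d \<in> ?S then fourier \<psi> d v else 0)" for d
      using projection_exists by blast
    \<comment> \<open>\<open>fourier'\<close> at \<open>d\<close> is, up to Frobenius,
      \<open>fourier\<close> at \<open>conjugate d\<close>; hence the choice of the class of
      \<open>conjugate a\<close>.\<close>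
    have w': "fourier' p \<nu> \<psi> d (w * v) = (if conjugate d \<in> ?S then fourier' p \<nu> \<psi> d v else 0)" for d
    proof (cases "conjugate d \<in> ?S")
      case True
      then have "Poly_Mapping.lookup (fourier' p \<nu> \<psi> d (w * v)) b ^ (p ^ \<nu>) =
          Poly_Mapping.lookup (fourier' p \<nu> \<psi> d v) b ^ (p ^ \<nu>)" for b
        by (simp only: w if_True flip: lookup_fourier_conj)
      then show ?thesis
        using True by (simp add: poly_mapping_eq_iff fun_eq_iff frobenius_eq_iff)
    next
      case False
      then show ?thesis
        by (simp only: fourier'_eq_0_iff w if_False)
    qed
    \<comment> \<open>Either \<open>d\<close> lies on the orbit of \<open>a\<close>, along which the
      vanishing at \<open>a\<close> spreads, or the second argument of the pairing is zero.\<close>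
    have "pairing d c (w * v) = 0" if "c \<in> C" for c d
    proof (cases "conjugate d \<in> ?S")
      case True
      then obtain i where "conjugate d = (step ^^ i) (conjugate a)"
        unfolding cyclotomic_class_eq_funpow by blast
      then have "d = (step ^^ i) a"
        by (simp only: conjugate_eq_iff flip: conjugate_funpow_step)
      moreover have "pairing d c (w * v) = pairing d c v"
        using True by (simp add: pairing_def w')
      ultimately show ?thesis
        using pairing that by (simp add: pairing_funpow_eq_0)
    qed (simp add: pairing_def w' euclidean_ip_def)
    then have "w * v \<in> hermitian_dual UNIV C"
      unfolding hermitian_dual_iff_pairing[OF C] by blast
    moreover have "w * v \<in> C"
      using C v by (simp add: abelian_code_def)
    ultimately have "w * v = 0"
      using hcd unfolding hermitian_complementary_dual_def by blast
    then show "fourier' p \<nu> \<psi> a v = 0"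
      using w'[of a] self_in_cyclotomic_class[of "conjugate a"] by simp
  qed
qed

section \<open>From nondegeneracy to conditions on the components\<close>

lemma nondegenerate_at_type_I':
  fixes C :: "('a \<times> 'b::{ab_group_add,finite} \<Rightarrow>\<^sub>0 'f) set"
  assumes C: "0 \<in> C" and I: "type_I' p \<nu> a"
  shows "nondegenerate_at C a \<longleftrightarrow>
    hermitian_complementary_dual (fourier_field p \<nu> a) (fourier \<psi> a ` C)"
proof -
  let ?K = "fourier_field p \<nu> a :: 'f alg_closure set"
  have Q: "hermitian_exponent ?K = p ^ (\<nu> * card (cyclotomic_class (p ^ (2 * \<nu>)) a))"
    using card_fourier_field by (rule hermitian_exponent_eqI)
  have ip: "hermitian_ip ?K (fourier \<psi> a c) (fourier \<psi> a v) = pairing a c v"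
    for c v :: "'a \<times> 'b \<Rightarrow>\<^sub>0 'f"
    by (simp add: hermitian_ip_def pairing_def euclidean_ip_def lookup_fourier'_type_I'[OF I])
  \<comment> \<open>The Hermitian exponent is positive by \<open>Q\<close>, so conjugation preserves
    and reflects zero.\<close>
  have z: "fourier' p \<nu> \<psi> a v = 0 \<longleftrightarrow> fourier \<psi> a v = 0"
    for v :: "'a \<times> 'b \<Rightarrow>\<^sub>0 'f"
    by (simp add: poly_mapping_eq_iff fun_eq_iff lookup_fourier'_type_I'[OF I] Q)
  have "0 \<in> fourier \<psi> a ` C \<inter> hermitian_dual ?K (fourier \<psi> a ` C)"
    using image_eqI[of 0 "fourier \<psi> a" 0 C] C fourier_in_group_algebra[of a 0] ip[of _ 0]
    by (auto simp: hermitian_dual_def pairing_def euclidean_ip_def)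
  then have "hermitian_complementary_dual ?K (fourier \<psi> a ` C) \<longleftrightarrow>
      (\<forall>w \<in> fourier \<psi> a ` C. w \<in> hermitian_dual ?K (fourier \<psi> a ` C) \<longrightarrow> w = 0)"
    unfolding hermitian_complementary_dual_def by blast
  also have "\<dots> \<longleftrightarrow> nondegenerate_at C a"
    by (simp add: nondegenerate_at_def hermitian_dual_def fourier_in_group_algebra ip z)
  finally show ?thesis by simp
qed

text \<open>Common form of the two intersection conditions: \<open>f\<close> and \<open>g\<close>
  are \<open>fourier\<close> and \<open>fourier'\<close> in either order.\<close>

lemma inter_euclidean_dual_image_eq_0_iff:
  assumes "0 \<in> C" "f 0 = 0" "\<And>u. f u \<in> group_algebra K"
  shows "f ` C \<inter> euclidean_dual K (g ` C) = {0} \<longleftrightarrow>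
    (\<forall>v\<in>C. (\<forall>c\<in>C. euclidean_ip (g c) (f v) = 0) \<longrightarrow> f v = 0)"
proof -
  have "0 \<in> f ` C \<inter> euclidean_dual K (g ` C)"
    using assms(3)[of 0] assms(1,2) image_eqI[of 0 f 0 C]
    by (auto simp: euclidean_dual_def euclidean_ip_def)
  then have "f ` C \<inter> euclidean_dual K (g ` C) = {0} \<longleftrightarrow>
      (\<forall>w \<in> f ` C. w \<in> euclidean_dual K (g ` C) \<longrightarrow> w = 0)"
    by blast
  then show ?thesis
    using assms(3) by (simp add: euclidean_dual_def)
qed

lemma nondegenerate_at_iff_dual_fourier':
  assumes "0 \<in> C"
  shows "nondegenerate_at C a \<longleftrightarrow>
    fourier' p \<nu> \<psi> a ` C \<inter> euclidean_dual (fourier_field p \<nu> a) (fourier \<psi> a ` C) = {0}"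
  using assms
  by (simp add: inter_euclidean_dual_image_eq_0_iff fourier'_in_group_algebra
      nondegenerate_at_def pairing_def)

lemma nondegenerate_at_conj_iff_dual_fourier:
  assumes "0 \<in> C"
  shows "nondegenerate_at C (conjugate a) \<longleftrightarrow>
    fourier \<psi> a ` C \<inter> euclidean_dual (fourier_field p \<nu> a) (fourier' p \<nu> \<psi> a ` C) = {0}"
  using assms
  by (simp add: inter_euclidean_dual_image_eq_0_iff fourier_in_group_algebra
      nondegenerate_at_def pairing_conj fourier'_conj_eq_0_iff)

text \<open>Every \<open>a\<close> lies on the forward orbit of some representative, along which
  nondegeneracy is inherited.\<close>

lemma nondegenerate_at_iff_representatives:
  assumes "class_representatives p \<nu> r1 r2 rep"
  shows "(\<forall>a. nondegenerate_at C a) \<longleftrightarrow> (\<forall>i\<in>{1..r1 + 2 * r2}. nondegenerate_at C (rep i))"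
proof
  assume R: "\<forall>i\<in>{1..r1 + 2 * r2}. nondegenerate_at C (rep i)"
  show "\<forall>a. nondegenerate_at C a"
  proof
    fix a
    have "cyclotomic_class (p ^ (2 * \<nu>)) a \<in>
        (\<lambda>i. cyclotomic_class (p ^ (2 * \<nu>)) (rep i)) ` {1..r1 + 2 * r2}"
      using assms unfolding class_representatives_def bij_betw_def by blast
    then obtain i where i: "i \<in> {1..r1 + 2 * r2}"
      and "cyclotomic_class (p ^ (2 * \<nu>)) a = cyclotomic_class (p ^ (2 * \<nu>)) (rep i)"
      by blast
    then have "a \<in> cyclotomic_class (p ^ (2 * \<nu>)) (rep i)"
      using self_in_cyclotomic_class by blast
    then obtain k where "a = (step ^^ k) (rep i)"
      unfolding cyclotomic_class_eq_funpow by blast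
    then show "nondegenerate_at C a"
      using R i nondegenerate_at_funpow by blast
  qed
qed blast

end

section \<open>Assembly over the representatives\<close>

lemma ball_atLeastAtMost_1_add:
  "(\<forall>i\<in>{1..m + n}. P i) \<longleftrightarrow> (\<forall>i\<in>{1..m}. P i) \<and> (\<forall>i\<in>{1..n}. P (m + i))" for m n :: nat
proof -
  have "{1..m + n} = {1..m} \<union> (\<lambda>i. m + i) ` {1..n}"
    by (auto simp: image_add_atLeastAtMost)
  then show ?thesis by (simp only: ball_Un ball_simps)
qed

theorem proposition5p1:
  fixes p \<nu> r1 r2 :: nat
    and rep :: "nat \<Rightarrow> 'a::{ab_group_add,finite}"
    and \<psi> :: "'a \<Rightarrow> 'a \<Rightarrow> 'f::finite_field alg_closure"
    and C :: "('a \<times> 'b::{ab_group_add,finite} \<Rightarrow>\<^sub>0 'f) set"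
    and K :: "nat \<Rightarrow> 'f alg_closure set"
    and Cc D D' :: "nat \<Rightarrow> ('b \<Rightarrow>\<^sub>0 'f alg_closure) set"
  assumes "prime p" and "\<nu> > 0"
    and "CARD('f) = p ^ (2 * \<nu>)"
    and "\<not> p dvd CARD('a)"
    and "\<exists>k. CARD('b) = p ^ k"
    and "character_iso \<psi>"
    and "class_representatives p \<nu> r1 r2 rep"
    and "abelian_code C"
    and "\<And>i. K i = fourier_field p \<nu> (rep i)"
    and "\<And>j. Cc j = fourier \<psi> (rep j) ` C"
    and "\<And>l. D l = fourier \<psi> (rep (r1 + l)) ` C"
    and "\<And>l. D' l = fourier' p \<nu> \<psi> (rep (r1 + l)) ` C"
  shows "hermitian_complementary_dual UNIV C \<longleftrightarrow>
    (\<forall>j\<in>{1..r1}. hermitian_complementary_dual (K j) (Cc j)) \<and>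
    (\<forall>l\<in>{1..r2}. D l \<inter> euclidean_dual (K (r1 + l)) (D' l) = {0} \<and>
                 D' l \<inter> euclidean_dual (K (r1 + l)) (D l) = {0})"
proof -
  interpret code_fourier p \<nu> \<psi>
    using assms(1-4,6) by unfold_locales
  have zero: "0 \<in> C"
    using assms(8) by (simp add: abelian_code_def)
  have rep: "j \<in> {1..r1} \<Longrightarrow> type_I' p \<nu> (rep j)"
    "l \<in> {1..r2} \<Longrightarrow> rep (r1 + r2 + l) = - nat_mult (p ^ \<nu>) (rep (r1 + l))" for j l
    using assms(7) by (auto simp: class_representatives_def)
  have "hermitian_complementary_dual UNIV C \<longleftrightarrow>
      (\<forall>i\<in>{1..r1 + r2 + r2}. nondegenerate_at C (rep i))"
    using hermitian_complementary_dual_iff_nondegenerate[OF assms(8)]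
      nondegenerate_at_iff_representatives[OF assms(7), of C]
    by (simp add: mult_2 add.assoc)
  \<comment> \<open>The index range splits into three blocks; the last consists of the conjugates of
    the second, so each \<open>l\<close> yields two conditions.\<close>
  also have "\<dots> \<longleftrightarrow> (\<forall>j\<in>{1..r1}. nondegenerate_at C (rep j)) \<and>
      (\<forall>l\<in>{1..r2}. nondegenerate_at C (- nat_mult (p ^ \<nu>) (rep (r1 + l))) \<and>
                   nondegenerate_at C (rep (r1 + l)))"
    unfolding ball_atLeastAtMost_1_add using rep(2) by auto
  also have "\<dots> \<longleftrightarrow> (\<forall>j\<in>{1..r1}. hermitian_complementary_dual (K j) (Cc j)) \<and>
    (\<forall>l\<in>{1..r2}. D l \<inter> euclidean_dual (K (r1 + l)) (D' l) = {0} \<and>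
                 D' l \<inter> euclidean_dual (K (r1 + l)) (D l) = {0})"
    unfolding assms(9-12)
    using rep(1) nondegenerate_at_type_I'[OF zero]
      nondegenerate_at_iff_dual_fourier'[OF zero]
      nondegenerate_at_conj_iff_dual_fourier[OF zero]
    by simp
  finally show ?thesis .
qed

end
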